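(* Let $k \geq 2$ be an integer. Then the sequence $(\nu_k(n+1))_{n \geq 0}$ is a $k$-regular sequence of rank $2$.
   Context: For integers $k \geq 2$ (not necessarily prime) and $n \geq 1$, $\nu_k(n)$ is the exponent of the highest power of $k$ that divides $n$, i.e. the largest integer $e \ge 0$ with $k^e \mid n$. The $k$-kernel of a sequence $s(n)_{n \geq 0}$ is the set of sequences $\ker_k s(n)_{n\ge 0} = \{ s(k^e n + i)_{n \geq 0} : e \geq 0,\ 0 \leq i \leq k^e - 1 \}$. The sequence $s(n)_{n \geq 0}$ is $k$-regular if the $\mathbb{Z}$-module $\langle \ker_k s(n)_{n\ge 0} \rangle$ generated by its $k$-kernel (under termwise operations) is finitely generated. The rank of a $k$-regular sequence is the rank of this $\mathbb{Z}$-module (the maximal number of $\mathbb{Z}$-linearly independent elements). *)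

theory Defs
  imports Complex_Main
    "HOL-Library.Function_Algebras"
    "HOL-Library.Extended_Nat"
    "HOL-Computational_Algebra.Primes"
begin

text \<open>
  Integer sequences are functions of type \<^typ>\<open>nat \<Rightarrow> int\<close>; they form a \<open>\<int>\<close>-module under
  the termwise operations (termwise addition is the one of \<^theory>\<open>HOL-Library.Function_Algebras\<close>).
\<close>

definition seq_scale :: "int \<Rightarrow> (nat \<Rightarrow> int) \<Rightarrow> nat \<Rightarrow> int" where
  "seq_scale c s = (\<lambda>n. c * s n)"

global_interpretation int_seq: module seq_scale
  by unfold_locales (auto simp: seq_scale_def fun_eq_iff algebra_simps)

definition k_kernel :: "nat \<Rightarrow> (nat \<Rightarrow> int) \<Rightarrow> (nat \<Rightarrow> int) set" where
  "k_kernel k s = {(\<lambda>n. s (k ^ e * n + i)) | e i. i < k ^ e}"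

definition k_kernel_module :: "nat \<Rightarrow> (nat \<Rightarrow> int) \<Rightarrow> (nat \<Rightarrow> int) set" where
  "k_kernel_module k s = int_seq.span (k_kernel k s)"

definition finitely_generated :: "(nat \<Rightarrow> int) set \<Rightarrow> bool" where
  "finitely_generated M \<longleftrightarrow> (\<exists>B. finite B \<and> M = int_seq.span B)"

definition k_regular :: "nat \<Rightarrow> (nat \<Rightarrow> int) \<Rightarrow> bool" where
  "k_regular k s \<longleftrightarrow> finitely_generated (k_kernel_module k s)"

text \<open>
  The rank takes values in \<^typ>\<open>enat\<close>, so that a module containing arbitrarily large finite
  independent sets gets rank \<open>\<infinity>\<close>; a finite supremum is attained.
\<close>

definition module_rank :: "(nat \<Rightarrow> int) set \<Rightarrow> enat" where
  "module_rank M = (SUP B \<in> {B. finite B \<and> B \<subseteq> M \<and> int_seq.independent B}. enat (card B))"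

definition k_rank :: "nat \<Rightarrow> (nat \<Rightarrow> int) \<Rightarrow> enat" where
  "k_rank k s = module_rank (k_kernel_module k s)"

text \<open>
  The valuation \<open>\<nu>\<^sub>k\<close> is the library function \<^const>\<open>multiplicity\<close>, which is defined for every base,
  prime or not, as the largest \<open>e\<close> with \<open>k ^ e dvd n\<close> (for \<open>k \<ge> 2\<close> and \<open>n \<ge> 1\<close>).
\<close>

end

theory Submission imports Defs begin

text \<open>
  The residue \<open>k ^ e - 1\<close> modulo \<open>k ^ e\<close> contributes \<open>e + \<nu>\<^sub>k(n + 1)\<close> to the kernel, and every other
  residue contributes a constant. Hence the kernel spans the module generated by the sequence and
  the constant \<open>1\<close>, which are linearly independent.
\<close>

lemma multiplicity_power_times_same:
  fixes k n :: nat
  assumes "k \<ge> 2" "n > 0"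
  shows "multiplicity k (k ^ e * n) = e + multiplicity k n"
proof (induction e)
  case (Suc e)
  have "multiplicity k (k * (k ^ e * n)) = Suc (multiplicity k (k ^ e * n))"
    using assms by (intro multiplicity_times_same) auto
  with Suc show ?case by (simp add: mult.assoc)
qed simp

text \<open>The bound \<open>j < k ^ e\<close> forces \<open>multiplicity k j < e\<close>, so
  \<open>k ^ e * n\<close> is divisible by one more power of \<open>k\<close> than \<open>j\<close>
  is and cannot disturb its valuation. Only powers of the single base \<open>k\<close> are compared,
  so composite \<open>k\<close> causes no trouble.\<close>

lemma multiplicity_power_times_add:
  fixes k n j :: nat
  assumes "k \<ge> 2" "0 < j" "j < k ^ e"
  shows "multiplicity k (k ^ e * n + j) = multiplicity k j"
proof (rule multiplicity_eqI)
  let ?m = "multiplicity k j"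
  have "k ^ ?m \<le> j"
    using assms by (intro dvd_imp_le multiplicity_dvd) auto
  with assms have "k ^ ?m < k ^ e" by linarith
  with assms have "?m < e" by (simp add: power_strict_increasing_iff)
  then have dvd: "k ^ Suc ?m dvd k ^ e * n" "k ^ ?m dvd k ^ e * n"
    by (simp_all only: le_imp_power_dvd Suc_leI less_imp_le dvd_mult2)
  then show "k ^ ?m dvd k ^ e * n + j"
    by (simp add: multiplicity_dvd)
  \<comment> \<open>Positivity of \<open>j\<close> matters: every power divides 0, yet
    \<open>multiplicity k 0\<close> is 0 by convention.\<close>
  have "\<not> k ^ Suc ?m dvd j"
    using assms power_dvd_iff_le_multiplicity[of j k "Suc ?m"] by (simp del: power_Suc)
  with dvd show "\<not> k ^ Suc ?m dvd k ^ e * n + j"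
    by (simp only: dvd_add_right_iff not_False_eq_True)
qed

lemma span_pairE:
  assumes "x \<in> int_seq.span {f, g}"
  obtains a b where "x = seq_scale a f + seq_scale b g"
proof -
  obtain a where "x - seq_scale a f \<in> int_seq.span {g}"
    using assms int_seq.span_breakdown_eq by blast
  then obtain b where "x - seq_scale a f = seq_scale b g"
    by (auto simp: int_seq.span_singleton)
  then have "x = seq_scale a f + seq_scale b g"
    by (simp add: algebra_simps)
  then show ?thesis by (rule that)
qed

text \<open>Dependence is witnessed by a coefficient function on a set, so distinctness is what
  allows \<open>a\<close> and \<open>b\<close> to be prescribed separately.\<close>

lemma dependent_pair:
  assumes "x \<noteq> y" "seq_scale a x + seq_scale b y = 0" "a \<noteq> 0 \<or> b \<noteq> 0" "x \<in> B" "y \<in> B"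
  shows "int_seq.dependent B"
  unfolding int_seq.dependent_explicit using assms
  by (intro exI[of _ "{x, y}"] exI[of _ "\<lambda>v. if v = x then a else b"]) auto

lemma dependent_triple:
  assumes "x \<noteq> y" "x \<noteq> z" "y \<noteq> z"
    and "seq_scale a x + seq_scale b y + seq_scale c z = 0" "a \<noteq> 0 \<or> b \<noteq> 0 \<or> c \<noteq> 0"
    and "x \<in> B" "y \<in> B" "z \<in> B"
  shows "int_seq.dependent B"
  unfolding int_seq.dependent_explicit using assms
  by (intro exI[of _ "{x, y, z}"] exI[of _ "\<lambda>v. if v = x then a else if v = y then b else c"])
    (auto simp: add.assoc)

text \<open>Scalars are integers, so elimination has to avoid division: any three elements satisfy
  the relation given by Cramer's rule. If its last coefficient vanishes, the first two elements are
  already proportional or one of them is zero.\<close>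

lemma card_independent_le_2:
  assumes "B \<subseteq> int_seq.span {f, g}" "int_seq.independent B"
  shows "card B \<le> 2"
proof (rule ccontr)
  assume "\<not> card B \<le> 2"
  then have "3 \<le> card B" by simp
  then obtain T where "T \<subseteq> B" "card T = 3"
    by (rule obtain_subset_with_card_n)
  then obtain x y z where B: "x \<in> B" "y \<in> B" "z \<in> B" and ne: "x \<noteq> y" "x \<noteq> z" "y \<noteq> z"
    by (auto simp: card_3_iff)
  obtain a1 b1 where x: "x = seq_scale a1 f + seq_scale b1 g"
    using assms(1) B span_pairE by blast
  obtain a2 b2 where y: "y = seq_scale a2 f + seq_scale b2 g"
    using assms(1) B span_pairE by blast
  obtain a3 b3 where z: "z = seq_scale a3 f + seq_scale b3 g"
    using assms(1) B span_pairE by blast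
  \<comment> \<open>The coefficients of the relation are the \<open>2 \<times> 2\<close> minors of the coordinate matrix.\<close>
  have rel: "seq_scale (a2 * b3 - a3 * b2) x + seq_scale (a3 * b1 - a1 * b3) y
      + seq_scale (a1 * b2 - a2 * b1) z = 0"
    by (simp add: x y z seq_scale_def fun_eq_iff algebra_simps)
  have minor: "a1 * b2 - a2 * b1 = 0"
    using dependent_triple[OF ne rel _ B] assms(2) by blast
  \<comment> \<open>These combinations cancel \<open>f\<close> and \<open>g\<close> respectively;
    what remains is a multiple of the minor just shown to vanish.\<close>
  have "seq_scale a2 x + seq_scale (- a1) y = seq_scale (- (a1 * b2 - a2 * b1)) g"
    "seq_scale b2 x + seq_scale (- b1) y = seq_scale (a1 * b2 - a2 * b1) f"
    by (simp_all add: x y seq_scale_def fun_eq_iff algebra_simps)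
  then have "seq_scale a2 x + seq_scale (- a1) y = 0" "seq_scale b2 x + seq_scale (- b1) y = 0"
    unfolding minor by (simp_all add: seq_scale_def fun_eq_iff)
  then have "a1 = 0" "b1 = 0"
    using dependent_pair[OF ne(1) _ _ B(1,2)] assms(2) neg_equal_0_iff_equal by blast+
  then have "x = 0" by (simp add: x)
  then show False using B assms(2) int_seq.dependent_zero by blast
qed

lemma k_kernel_module_multiplicity:
  fixes k :: nat
  assumes "k \<ge> 2"
  defines "s \<equiv> \<lambda>n. int (multiplicity k (n + 1))"
  shows "k_kernel_module k s = int_seq.span {s, 1}"
  unfolding k_kernel_module_def
proof (rule int_seq.span_eq[THEN iffD2], intro conjI subsetI)
  fix t assume "t \<in> k_kernel k s"
  then obtain e i where t: "t = (\<lambda>n. s (k ^ e * n + i))" and i: "i < k ^ e"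
    by (auto simp: k_kernel_def)
  show "t \<in> int_seq.span {s, 1}"
  proof (cases "i + 1 = k ^ e")
    case True
    have "s (k ^ e * n + i) = int e + s n" for n
    proof -
      have "k ^ e * n + i + 1 = k ^ e * (n + 1)"
        using True by (simp add: algebra_simps)
      then show ?thesis
        using multiplicity_power_times_same[of k "n + 1" e] assms(1) by (simp only: s_def)
    qed
    then have "t = seq_scale 1 s + seq_scale (int e) 1"
      by (simp add: t seq_scale_def fun_eq_iff)
    then show ?thesis
      by (simp only:) (intro int_seq.span_add int_seq.span_scale int_seq.span_base insertI1 insertI2)
  next
    case False
    \<comment> \<open>The shift in \<open>s\<close> turns the residue \<open>i\<close> into
      \<open>i + 1\<close>, which is positive and, in this case, still below
      \<open>k ^ e\<close>.\<close>
    have "s (k ^ e * n + i) = s i" for n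
      using multiplicity_power_times_add[of k "i + 1" e n] assms(1) i False by (simp add: s_def)
    then have "t = seq_scale (s i) 1"
      by (simp add: t seq_scale_def fun_eq_iff)
    then show ?thesis
      by (simp only:) (intro int_seq.span_scale int_seq.span_base insertI1 insertI2)
  qed
next
  fix t assume t: "t \<in> {s, 1}"
  have "(\<lambda>n. s (k ^ 0 * n + 0)) \<in> k_kernel k s"
    unfolding k_kernel_def using assms(1) by (intro CollectI exI[of _ 0]) auto
  then have s: "s \<in> int_seq.span (k_kernel k s)"
    by (auto intro: int_seq.span_base)
  \<comment> \<open>The last residue modulo \<open>k\<close> yields \<open>s + 1\<close>, so
    subtracting \<open>s\<close> isolates the constant sequence.\<close>
  have "(\<lambda>n. s (k ^ 1 * n + (k - 1))) \<in> k_kernel k s"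
    unfolding k_kernel_def using assms(1) by (intro CollectI exI[of _ 1] exI[of _ "k - 1"]) auto
  moreover have "(\<lambda>n. s (k ^ 1 * n + (k - 1))) - s = 1"
  proof
    fix n
    have "k ^ 1 * n + (k - 1) + 1 = k ^ 1 * (n + 1)"
      using assms(1) by simp
    then show "((\<lambda>n. s (k ^ 1 * n + (k - 1))) - s) n = 1 n"
      using multiplicity_power_times_same[of k "n + 1" 1] assms(1) by (simp only: s_def fun_diff_def) simp
  qed
  ultimately have "1 \<in> int_seq.span (k_kernel k s)"
    using s int_seq.span_diff int_seq.span_base by metis
  with s t show "t \<in> int_seq.span (k_kernel k s)" by auto
qed

text \<open>Two evaluations suffice: \<open>s\<close> is 0 at 0, which kills the coefficient of
  \<open>1\<close>, and 1 at \<open>k - 1\<close>, which then kills that of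
  \<open>s\<close>.\<close>

lemma independent_multiplicity_one:
  fixes k :: nat
  assumes "k \<ge> 2"
  defines "s \<equiv> \<lambda>n. int (multiplicity k (n + 1))"
  shows "int_seq.independent {s, 1}" "s \<noteq> 1"
proof -
  have s0: "s 0 = 0" by (simp add: s_def)
  have sk: "s (k - 1) = 1"
    using assms(1) multiplicity_power_times_same[of k 1 1] by (simp add: s_def)
  show ne: "s \<noteq> 1" using s0 by (metis one_fun_apply zero_neq_one)
  show "int_seq.independent {s, 1}"
  proof
    assume "int_seq.dependent {s, 1}"
    then obtain u where nz: "u s \<noteq> 0 \<or> u 1 \<noteq> 0" and "(\<Sum>v\<in>{s, 1}. seq_scale (u v) v) = 0"
      by (auto simp: int_seq.dependent_finite)
    then have eq: "u s * s n + u 1 = 0" for n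
      using ne by (simp add: seq_scale_def fun_eq_iff)
    from eq[of 0] eq[of "k - 1"] nz show False unfolding s0 sk by simp
  qed
qed

theorem theorem1p5:
  fixes k :: nat
  assumes "k \<ge> 2"
  shows "k_regular k (\<lambda>n. int (multiplicity k (n + 1)))
       \<and> k_rank k (\<lambda>n. int (multiplicity k (n + 1))) = 2"
proof
  let ?s = "\<lambda>n. int (multiplicity k (n + 1))"
  note module = k_kernel_module_multiplicity[OF assms]
  show "k_regular k ?s"
    unfolding k_regular_def finitely_generated_def module
    by (intro exI[of _ "{?s, 1}"] conjI refl finite.intros)
  show "k_rank k ?s = 2"
    unfolding k_rank_def module_rank_def module
  proof (rule antisym)
    show "(SUP B \<in> {B. finite B \<and> B \<subseteq> int_seq.span {?s, 1} \<and> int_seq.independent B}.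
        enat (card B)) \<le> 2"
      by (rule SUP_least) (metis (lifting) mem_Collect_eq card_independent_le_2 enat_ord_simps(1) numeral_eq_enat)
    \<comment> \<open>The generators themselves attain the bound; the set has two elements because
      \<open>?s\<close> is not the constant \<open>1\<close>.\<close>
    have "2 = enat (card {?s, 1})"
      using independent_multiplicity_one(2)[OF assms] by (simp add: numeral_eq_enat)
    also have "\<dots> \<le> (SUP B \<in> {B. finite B \<and> B \<subseteq> int_seq.span {?s, 1} \<and> int_seq.independent B}.
        enat (card B))"
      using independent_multiplicity_one(1)[OF assms] int_seq.span_superset
      by (intro SUP_upper CollectI conjI finite.intros)
    finally show "2 \<le> (SUP B \<in> {B. finite B \<and> B \<subseteq> int_seq.span {?s, 1} \<and> int_seq.independent B}.
        enat (card B))" .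
  qed
qed

end
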